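(* There exists an absolute constant $C>0$ such that the following holds. Let $x_1,\dots,x_k$ be vectors in $\mathbb{R}^m$ with equal Euclidean norms satisfying $$\mathrm{id}=\sum_{j\le k}x_j\otimes x_j.$$ Let $n$ be an integer with $1<n\le k$, and let $\sigma$ be a random subset of $\{1,\dots,k\}$ in which each element of $\{1,\dots,k\}$ is included independently with probability $n/k$. Then for every $0<t<1$, with probability at least $1-6\exp(-t^2/\varepsilon^2)$, where $\varepsilon=C\sqrt{\log n}\cdot\sqrt{\frac{m}{n}}$, the set $\sigma$ is non-empty and $$\Big\|\mathrm{id}-\frac{k}{|\sigma|}\sum_{j\in\sigma}x_j\otimes x_j\Big\|<t.$$
   Context: $\mathrm{id}$ is the identity operator on $\mathbb{R}^m$, $x\otimes x$ is the operator $z\mapsto\langle x,z\rangle x$, and $\|\cdot\|$ is the operator norm on Euclidean $\mathbb{R}^m$. *)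

theory Defs
  imports "HOL-Probability.Probability" "Jordan_Normal_Form.Matrix"
begin

(* The dimension m has to be quantified inside the scope of the absolute constant, so R^m is
   carrier_vec m and operators on it are matrices in carrier_mat m m, rather than types
   indexed by a finite type. *)

definition eucl_norm :: "real vec \<Rightarrow> real" where
  "eucl_norm v = sqrt (scalar_prod v v)"

definition op_norm :: "real mat \<Rightarrow> real" where
  "op_norm A = (SUP v \<in> {v \<in> carrier_vec (dim_col A). eucl_norm v \<le> 1}. eucl_norm (A *\<^sub>v v))"

definition tensor_square :: "real vec \<Rightarrow> real mat" where
  "tensor_square x = mat (dim_vec x) (dim_vec x) (\<lambda>(a, b). vec_index x a * vec_index x b)"

definition tensor_sum :: "nat \<Rightarrow> (nat \<Rightarrow> real vec) \<Rightarrow> nat set \<Rightarrow> real mat" where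
  "tensor_sum m x S = finsum (module_mat TYPE(real) m m) (\<lambda>j. tensor_square (x j)) S"

(* Pi_pmf is the product of independent coin flips, one for each element of A; flip j decides
   whether j is selected. *)
definition random_subset :: "'a set \<Rightarrow> real \<Rightarrow> 'a set pmf" where
  "random_subset A p = map_pmf (\<lambda>b. {j \<in> A. b j}) (Pi_pmf A False (\<lambda>_. bernoulli_pmf p))"

lemma tensor_square_carrier: "x \<in> carrier_vec m \<Longrightarrow> tensor_square x \<in> carrier_mat m m"
  by (auto simp: tensor_square_def)

lemma tensor_square_mult_vec:
  assumes "x \<in> carrier_vec m" "z \<in> carrier_vec m"
  shows "tensor_square x *\<^sub>v z = scalar_prod x z \<cdot>\<^sub>v x"
proof (rule eq_vecI)
  fix i assume i: "i < dim_vec (scalar_prod x z \<cdot>\<^sub>v x)"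
  then show "vec_index (tensor_square x *\<^sub>v z) i = vec_index (scalar_prod x z \<cdot>\<^sub>v x) i"
    using assms by (auto simp: tensor_square_def scalar_prod_def sum_distrib_left sum_distrib_right mult_ac
        intro!: sum.cong)
qed (use assms in \<open>auto simp: tensor_square_def\<close>)

lemma tensor_sum_insert:
  assumes "finite S" "j \<notin> S" "\<And>i. i \<in> insert j S \<Longrightarrow> x i \<in> carrier_vec m"
  shows "tensor_sum m x (insert j S) = tensor_square (x j) + tensor_sum m x S"
proof -
  interpret abelian_group "module_mat TYPE(real) m m" by (rule abelian_group_mat)
  show ?thesis
    unfolding tensor_sum_def
    by (subst finsum_insert) (use assms tensor_square_carrier in \<open>auto simp: module_mat_simps\<close>)
qed

lemma eucl_norm_L2_set: "eucl_norm v = L2_set (vec_index v) {0..<dim_vec v}"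
  by (simp add: eucl_norm_def L2_set_def scalar_prod_def power2_eq_square)

lemma abs_scalar_prod_le:
  assumes "dim_vec v = dim_vec w"
  shows "\<bar>scalar_prod v w\<bar> \<le> eucl_norm v * eucl_norm w"
proof -
  have "\<bar>scalar_prod v w\<bar> \<le> (\<Sum>i\<in>{0..<dim_vec w}. \<bar>vec_index v i\<bar> * \<bar>vec_index w i\<bar>)"
    unfolding scalar_prod_def by (rule order_trans[OF sum_abs]) (simp add: abs_mult)
  also have "\<dots> \<le> eucl_norm v * eucl_norm w"
    using L2_set_mult_ineq[of "vec_index v" "vec_index w"] assms by (simp add: eucl_norm_L2_set)
  finally show ?thesis .
qed

(* The supremum in op_norm is over a bounded set, hence a genuine one. *)
lemma op_norm_bdd_above:
  "bdd_above ((\<lambda>v. eucl_norm (A *\<^sub>v v)) ` {v \<in> carrier_vec (dim_col A). eucl_norm v \<le> 1})"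
proof (rule bdd_aboveI2)
  fix v assume v: "v \<in> {v \<in> carrier_vec (dim_col A). eucl_norm v \<le> 1}"
  have n0: "0 \<le> eucl_norm u" for u by (simp add: eucl_norm_L2_set)
  have "eucl_norm (A *\<^sub>v v) \<le> (\<Sum>i\<in>{0..<dim_row A}. \<bar>vec_index (A *\<^sub>v v) i\<bar>)"
    unfolding eucl_norm_L2_set by (rule order_trans[OF L2_set_le_sum_abs]) simp
  also have "\<dots> \<le> (\<Sum>i\<in>{0..<dim_row A}. eucl_norm (row A i))"
  proof (rule sum_mono)
    fix i assume "i \<in> {0..<dim_row A}"
    then have "\<bar>vec_index (A *\<^sub>v v) i\<bar> \<le> eucl_norm (row A i) * eucl_norm v"
      using abs_scalar_prod_le[of "row A i" v] v by auto
    also have "\<dots> \<le> eucl_norm (row A i)" using v n0 by (simp add: mult_left_le)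
    finally show "\<bar>vec_index (A *\<^sub>v v) i\<bar> \<le> eucl_norm (row A i)" .
  qed
  finally show "eucl_norm (A *\<^sub>v v) \<le> (\<Sum>i\<in>{0..<dim_row A}. eucl_norm (row A i))" .
qed

end

theory Submission
  imports Defs
begin

text \<open>
  Write \<open>p = n / k\<close> and let \<open>b\<^sub>j\<close> be the independent coins that select \<open>\<sigma>\<close>. The random operator
  \<open>X = \<Sum>\<^sub>j (b\<^sub>j / p - 1) x\<^sub>j \<otimes> x\<^sub>j\<close> has mean zero, and
  \<open>(1 / p) \<Sum>\<^bsub>j \<in> \<sigma>\<^esub> x\<^sub>j \<otimes> x\<^sub>j = id + X\<close>. So everything follows from a tail bound for \<open>\<parallel>X\<parallel>\<close>,
  which is obtained by the moment method applied to \<open>T\<^sub>i = E tr X\<^sup>i\<close>.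

  Since \<open>\<Sum>\<^sub>j x\<^sub>j \<otimes> x\<^sub>j = id\<close>, the trace is \<open>tr M = \<Sum>\<^sub>j \<langle>x\<^sub>j, M x\<^sub>j\<rangle>\<close>, hence
  \<open>tr X\<^bsup>2r+2\<^esup> = \<Sum>\<^sub>j (b\<^sub>j / p - 1) \<langle>x\<^sub>j, X\<^bsup>2r+1\<^esup> x\<^sub>j\<rangle>\<close>. Averaging the \<open>j\<close>-th summand over the \<open>j\<close>-th
  coin alone leaves \<open>1 - p\<close> times the difference of \<open>\<langle>x\<^sub>j, X\<^bsup>2r+1\<^esup> x\<^sub>j\<rangle>\<close> at the two values \<open>W\<close>, \<open>Y\<close> of \<open>X\<close>, and as
  \<open>W - Y = (1 / p) x\<^sub>j \<otimes> x\<^sub>j\<close> has rank one, telescoping turns it into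
  \<open>(1 / p) \<Sum>\<^bsub>i \<le> 2r\<^esub> \<langle>x\<^sub>j, W\<^sup>i x\<^sub>j\<rangle> \<langle>x\<^sub>j, Y\<^bsup>2r-i\<^esup> x\<^sub>j\<rangle>\<close>. The factors are moments, so they are
  dominated by geometric sequences, and the sum is at most
  \<open>(2r + 1) / 2 \<cdot> |x\<^sub>j|\<^sup>2 / p \<cdot> (\<langle>x\<^sub>j, W\<^bsup>2r\<^esup> x\<^sub>j\<rangle> + \<langle>x\<^sub>j, Y\<^bsup>2r\<^esup> x\<^sub>j\<rangle>)\<close>
  (\<open>frame_op_pow_diff_le\<close>). Here \<open>|x\<^sub>j|\<^sup>2 / p = m / n\<close>. Summing over \<open>j\<close> gives
  \<open>T\<^bsub>2r+2\<^esub> \<le> (2r + 1) / 2 \<cdot> m / n \<cdot> (T\<^bsub>2r+1\<^esub> + 2 T\<^bsub>2r\<^esub>)\<close> (\<open>moment_step\<close>), and together with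
  \<open>2 T\<^bsub>2r+1\<^esub> \<le> T\<^bsub>2r+2\<^esub> + T\<^bsub>2r\<^esub>\<close> this yields \<open>T\<^bsub>2Q\<^esub> \<le> m (5 Q m / n)\<^sup>Q\<close> as long as \<open>Q m \<le> n\<close>.

  Markov's inequality with \<open>Q\<close> a small multiple of \<open>t\<^sup>2 n / m\<close> bounds the probability of
  \<open>\<parallel>X\<parallel> \<ge> t / 4\<close> by \<open>m exp (- Q)\<close>. The factor \<open>m\<close> costs nothing: the claim is trivial unless
  \<open>t\<^sup>2 n / m\<close> is a large multiple of \<open>ln n\<close>, and then \<open>m \<le> n\<close> is absorbed by the exponential.
  The same event controls \<open>|\<sigma>|\<close>: as \<open>tr X = m (|\<sigma>| / n - 1)\<close>, the bound \<open>\<parallel>X\<parallel> \<le> t / 4\<close> forces \<open>|\<sigma>|\<close>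
  to be close to \<open>n\<close>, and \<open>1 / p = k / n\<close> may be replaced by \<open>k / |\<sigma>|\<close>.

  The comparisons between moments, which a spectral decomposition would reduce to inequalities
  between numbers, come from the log-convexity of the norms \<open>|X\<^sup>i v|\<close>, that is, from the
  Cauchy-Schwarz inequality.
\<close>

section \<open>Log-convex sequences and mixed powers\<close>

text \<open>
  For positive \<open>e\<close> this says that \<open>(e i / e 0)\<^bsup>1/i\<^esup>\<close> is nondecreasing. The form without roots and
  quotients also covers sequences with zeros.
\<close>
lemma log_convex_power_le:
  fixes e :: "nat \<Rightarrow> real"
  assumes nonneg: "\<And>i. 0 \<le> e i"
    and convex: "\<And>i. (e (Suc i))\<^sup>2 \<le> e i * e (Suc (Suc i))"
  shows "e i ^ Suc i \<le> e 0 * e (Suc i) ^ i"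
proof (induction i)
  case 0
  show ?case by simp
next
  case (Suc i)
  show ?case
  proof (cases "e (Suc i) = 0")
    case True
    then show ?thesis using nonneg by simp
  next
    case False
    then have pos: "0 < e (Suc i) ^ i"
      using nonneg[of "Suc i"] by simp
    have "e (Suc i) ^ i * e (Suc i) ^ Suc (Suc i) = ((e (Suc i))\<^sup>2) ^ Suc i"
      by (simp add: mult_2 flip: power_add power_mult)
    also have "\<dots> \<le> (e i * e (Suc (Suc i))) ^ Suc i"
      by (intro power_mono convex) auto
    also have "\<dots> \<le> (e 0 * e (Suc i) ^ i) * e (Suc (Suc i)) ^ Suc i"
      unfolding power_mult_distrib by (intro mult_right_mono Suc.IH zero_le_power nonneg)
    finally have "e (Suc i) ^ i * e (Suc i) ^ Suc (Suc i)
        \<le> e (Suc i) ^ i * (e 0 * e (Suc (Suc i)) ^ Suc i)"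
      by (simp add: mult_ac)
    then show ?thesis
      using pos by (simp only: mult_le_cancel_left_pos)
  qed
qed

text \<open>
  On a logarithmic scale, a convex sequence lies below its chord: between \<open>0\<close> and \<open>r\<close> it is dominated by the geometric
  sequence with the same end points. The ratio \<open>u\<close> is \<open>(e r / e 0)\<^bsup>1/r\<^esup>\<close>, which grows with \<open>r\<close>.
\<close>
lemma log_convex_geometric_bound:
  fixes e :: "nat \<Rightarrow> real"
  assumes nonneg: "\<And>i. 0 \<le> e i"
    and convex: "\<And>i. (e (Suc i))\<^sup>2 \<le> e i * e (Suc (Suc i))"
  obtains u where "0 \<le> u" "e r = e 0 * u ^ r" "\<And>i. i \<le> r \<Longrightarrow> e i \<le> e 0 * u ^ i"
proof -
  have "\<exists>u\<ge>0. e r = e 0 * u ^ r \<and> (\<forall>i\<le>r. e i \<le> e 0 * u ^ i)"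
  proof (cases "e 0 = 0")
    case True
    have "e i = 0" for i
    proof (induction i)
      case (Suc i)
      then show ?case using convex[of i] by simp
    qed (fact True)
    then show ?thesis by auto
  next
    case False
    then have e0: "0 < e 0" using nonneg[of 0] by simp
    show ?thesis
    proof (induction r)
      case 0
      show ?case by auto
    next
      case (Suc r)
      then obtain u where u: "0 \<le> u" "e r = e 0 * u ^ r" "\<And>i. i \<le> r \<Longrightarrow> e i \<le> e 0 * u ^ i"
        by auto
      define w where "w = root (Suc r) (e (Suc r) / e 0)"
      have w: "0 \<le> w" "e (Suc r) = e 0 * w ^ Suc r"
        using e0 nonneg[of "Suc r"]
        by (auto simp: w_def simp del: power_Suc)
      have "u ^ r \<le> w ^ r"
      proof (cases "r = 0")
        case False
        have "(e 0 * u ^ r) ^ Suc r \<le> e 0 * (e 0 * w ^ Suc r) ^ r"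
          using log_convex_power_le[of e r] nonneg convex u(2) w(2) by metis
        then have "e 0 ^ Suc r * (u ^ r) ^ Suc r \<le> e 0 ^ Suc r * (w ^ r) ^ Suc r"
          by (simp add: power_mult_distrib mult_ac flip: power_mult)
        then have "(u ^ r) ^ Suc r \<le> (w ^ r) ^ Suc r"
          using e0 by (simp del: power_Suc)
        then show ?thesis
          using w(1) by (meson power_le_imp_le_base zero_le_power)
      qed simp
      then have uw: "r = 0 \<or> u \<le> w"
        using w(1) by (cases r) (auto dest: power_le_imp_le_base simp del: power_Suc)
      have "e i \<le> e 0 * w ^ i" if "i \<le> Suc r" for i
      proof (cases "i \<le> r")
        case True
        have "u ^ i \<le> w ^ i"
          using uw True u(1) by (auto intro: power_mono)
        then show ?thesis
          using u(3)[OF True] e0 by (meson mult_left_mono less_imp_le order_trans)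
      next
        case False
        then show ?thesis using that w(2) by (simp add: le_Suc_eq)
      qed
      then show ?case using w by blast
    qed
  qed
  then show ?thesis using that by blast
qed

text \<open>
  The terms \<open>i\<close> and \<open>N - i\<close> are paired, and \<open>(u\<^sup>i - v\<^sup>i) (u\<^bsup>N-i\<^esup> - v\<^bsup>N-i\<^esup>) \<ge> 0\<close> because both
  factors have the same sign.
\<close>
lemma sum_mixed_powers_le:
  fixes u v :: real
  assumes "0 \<le> u" "0 \<le> v"
  shows "2 * (\<Sum>i<Suc N. u ^ i * v ^ (N - i)) \<le> real (Suc N) * (u ^ N + v ^ N)"
proof -
  have rev: "(\<Sum>i<Suc N. u ^ i * v ^ (N - i)) = (\<Sum>i<Suc N. u ^ (N - i) * v ^ i)"
    by (subst sum.nat_diff_reindex[symmetric]) (auto intro!: sum.cong)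
  have "u ^ i * v ^ (N - i) + u ^ (N - i) * v ^ i \<le> u ^ N + v ^ N" if "i < Suc N" for i
  proof -
    have "0 \<le> (u ^ i - v ^ i) * (u ^ (N - i) - v ^ (N - i))"
      using assms by (cases "u \<le> v") (simp_all add: power_mono mult_nonpos_nonpos)
    moreover have "u ^ i * u ^ (N - i) = u ^ N" "v ^ i * v ^ (N - i) = v ^ N"
      using that by (simp_all flip: power_add)
    ultimately show ?thesis by (simp add: algebra_simps)
  qed
  then have "(\<Sum>i<Suc N. u ^ i * v ^ (N - i) + u ^ (N - i) * v ^ i) \<le> (\<Sum>i<Suc N. u ^ N + v ^ N)"
    by (intro sum_mono) auto
  then show ?thesis
    by (simp add: sum.distrib rev del: sum.lessThan_Suc)
qed

lemma geometric_growth_bound: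
  fixes M :: "nat \<Rightarrow> real"
  assumes step: "\<And>q. q < Q \<Longrightarrow> M (Suc q) \<le> A * M q" and "0 \<le> A"
  shows "M Q \<le> A ^ Q * M 0"
proof -
  have "q \<le> Q \<Longrightarrow> M q \<le> A ^ q * M 0" for q
  proof (induction q)
    case (Suc q)
    then have "M (Suc q) \<le> A * M q" using step by simp
    also have "\<dots> \<le> A * (A ^ q * M 0)"
      using Suc assms(2) by (intro mult_left_mono) auto
    finally show ?case by simp
  qed simp
  then show ?thesis by simp
qed

section \<open>Euclidean space in coordinates\<close>

text \<open>
  The dimension is a variable here, so vectors are functions of which only the first \<open>m\<close>
  coordinates are read.
\<close>
definition coord_inner :: "nat \<Rightarrow> (nat \<Rightarrow> real) \<Rightarrow> (nat \<Rightarrow> real) \<Rightarrow> real" where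
  "coord_inner m u v = (\<Sum>a<m. u a * v a)"

definition coord_norm :: "nat \<Rightarrow> (nat \<Rightarrow> real) \<Rightarrow> real" where
  "coord_norm m v = L2_set v {..<m}"

lemma coord_norm_nonneg [simp]: "0 \<le> coord_norm m v"
  by (simp add: coord_norm_def)

lemma coord_norm_sq: "(coord_norm m v)\<^sup>2 = coord_inner m v v"
  by (simp add: coord_norm_def coord_inner_def L2_set_def sum_nonneg power2_eq_square)

lemma coord_inner_commute: "coord_inner m u v = coord_inner m v u"
  by (simp add: coord_inner_def mult.commute)

lemma coord_inner_add_right: "coord_inner m w (\<lambda>a. u a + t * v a) = coord_inner m w u + t * coord_inner m w v"
  by (simp add: coord_inner_def sum.distrib sum_distrib_left algebra_simps)

lemma coord_inner_sum_right: "coord_inner m w (\<lambda>a. \<Sum>j\<in>J. g j * u j a) = (\<Sum>j\<in>J. g j * coord_inner m w (u j))"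
proof -
  have "coord_inner m w (\<lambda>a. \<Sum>j\<in>J. g j * u j a) = (\<Sum>a<m. \<Sum>j\<in>J. g j * (w a * u j a))"
    by (simp add: coord_inner_def sum_distrib_left mult_ac)
  also have "\<dots> = (\<Sum>j\<in>J. \<Sum>a<m. g j * (w a * u j a))"
    by (rule sum.swap)
  finally show ?thesis
    by (simp add: coord_inner_def sum_distrib_left)
qed

lemma abs_coord_inner_le: "\<bar>coord_inner m u v\<bar> \<le> coord_norm m u * coord_norm m v"
proof -
  have "\<bar>coord_inner m u v\<bar> \<le> (\<Sum>a<m. \<bar>u a\<bar> * \<bar>v a\<bar>)"
    unfolding coord_inner_def by (rule order_trans[OF sum_abs]) (simp add: abs_mult)
  also have "\<dots> \<le> coord_norm m u * coord_norm m v"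
    unfolding coord_norm_def by (rule L2_set_mult_ineq)
  finally show ?thesis .
qed

lemma coord_norm_lincomb_le: "coord_norm m (\<lambda>a. r * u a + t * v a) \<le> \<bar>r\<bar> * coord_norm m u + \<bar>t\<bar> * coord_norm m v"
proof -
  have scale: "coord_norm m (\<lambda>a. r * u a) = \<bar>r\<bar> * coord_norm m u" for r u
    by (simp add: coord_norm_def L2_set_def power_mult_distrib real_sqrt_mult flip: sum_distrib_left)
  show ?thesis
    using L2_set_triangle_ineq[of "\<lambda>a. r * u a" "\<lambda>a. t * v a" "{..<m}"]
    by (simp add: scale flip: coord_norm_def)
qed

section \<open>Weighted sums of the rank-one operators of a Parseval frame\<close>

text \<open>
  The assumption \<open>resolution\<close> is \<open>id = \<Sum>\<^sub>j x\<^sub>j \<otimes> x\<^sub>j\<close>, entry by entry.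
\<close>
locale parseval_frame =
  fixes m :: nat and J :: "'i set" and x :: "'i \<Rightarrow> nat \<Rightarrow> real"
  assumes finite_J: "finite J"
    and resolution: "\<And>a b. a < m \<Longrightarrow> b < m \<Longrightarrow> (\<Sum>j\<in>J. x j a * x j b) = of_bool (a = b)"
begin

text \<open>
  The operator \<open>\<Sum>\<^sub>j c\<^sub>j x\<^sub>j \<otimes> x\<^sub>j\<close>.
\<close>
definition frame_op :: "('i \<Rightarrow> real) \<Rightarrow> (nat \<Rightarrow> real) \<Rightarrow> nat \<Rightarrow> real" where
  "frame_op c v = (\<lambda>a. \<Sum>j\<in>J. (c j * coord_inner m (x j) v) * x j a)"

text \<open>
  As \<open>\<Sum>\<^sub>j x\<^sub>j \<otimes> x\<^sub>j = id\<close>, this is the trace of the \<open>i\<close>-th power of the operator.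
\<close>
definition trace_pow :: "('i \<Rightarrow> real) \<Rightarrow> nat \<Rightarrow> real" where
  "trace_pow c i = (\<Sum>j\<in>J. coord_inner m (x j) ((frame_op c ^^ i) (x j)))"

lemma parseval: "(\<Sum>j\<in>J. coord_inner m (x j) u * coord_inner m (x j) v) = coord_inner m u v"
proof -
  have "(\<Sum>j\<in>J. coord_inner m (x j) u * coord_inner m (x j) v) = (\<Sum>j\<in>J. \<Sum>a<m. \<Sum>b<m. u a * v b * (x j a * x j b))"
    by (simp add: coord_inner_def sum_product mult_ac)
  also have "\<dots> = (\<Sum>a<m. \<Sum>b<m. \<Sum>j\<in>J. u a * v b * (x j a * x j b))"
    by (simp add: sum.swap[where A = J])
  also have "\<dots> = (\<Sum>a<m. \<Sum>b<m. u a * v b * of_bool (a = b))"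
    by (simp add: resolution flip: sum_distrib_left)
  also have "\<dots> = coord_inner m u v"
    by (simp add: coord_inner_def of_bool_def if_distrib cong: if_cong)
  finally show ?thesis .
qed

lemma coord_inner_frame_op: "coord_inner m u (frame_op c v) = (\<Sum>j\<in>J. c j * (coord_inner m (x j) u * coord_inner m (x j) v))"
  unfolding frame_op_def coord_inner_sum_right by (simp add: coord_inner_commute[of m u] mult_ac)

lemma frame_op_selfadjoint: "coord_inner m (frame_op c u) v = coord_inner m u (frame_op c v)"
  by (subst coord_inner_commute) (simp add: coord_inner_frame_op mult_ac)

lemma coord_inner_frame_op_pow: "coord_inner m ((frame_op c ^^ i) u) ((frame_op c ^^ l) v) = coord_inner m u ((frame_op c ^^ (i + l)) v)"
proof (induction i arbitrary: l)
  case (Suc i)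
  then show ?case
    using Suc.IH[of "Suc l"] by (simp add: frame_op_selfadjoint)
qed simp

lemma frame_op_pow_selfadjoint: "coord_inner m ((frame_op c ^^ i) u) v = coord_inner m u ((frame_op c ^^ i) v)"
  using coord_inner_frame_op_pow[where l = 0 and i = i] by simp

lemma frame_op_pow_swap: "coord_inner m v ((frame_op c ^^ i) u) = coord_inner m u ((frame_op c ^^ i) v)"
  by (subst coord_inner_commute) (rule frame_op_pow_selfadjoint)

lemma frame_op_add: "frame_op c (\<lambda>a. u a + t * v a) = (\<lambda>a. frame_op c u a + t * frame_op c v a)"
  by (simp add: frame_op_def coord_inner_add_right sum.distrib sum_distrib_left algebra_simps)

lemma frame_op_pow_add:
  "(frame_op c ^^ i) (\<lambda>a. u a + t * v a) = (\<lambda>a. (frame_op c ^^ i) u a + t * (frame_op c ^^ i) v a)"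
  by (induction i) (simp_all add: frame_op_add)

lemma abs_coord_inner_frame_op_pow_le:
  "\<bar>coord_inner m v ((frame_op c ^^ (i + l)) v)\<bar> \<le> coord_norm m ((frame_op c ^^ i) v) * coord_norm m ((frame_op c ^^ l) v)"
  using abs_coord_inner_le[of m "(frame_op c ^^ i) v" "(frame_op c ^^ l) v"] by (simp only: coord_inner_frame_op_pow)

lemma coord_norm_frame_op_pow_sq: "(coord_norm m ((frame_op c ^^ i) v))\<^sup>2 = coord_inner m v ((frame_op c ^^ (2 * i)) v)"
  by (simp only: coord_norm_sq coord_inner_frame_op_pow mult_2)

text \<open>
  The sequence \<open>|X\<^sup>i v|\<close> is log-convex, since \<open>|X\<^bsup>i+1\<^esup> v|\<^sup>2 = \<langle>X\<^sup>i v, X\<^bsup>i+2\<^esup> v\<rangle>\<close> for selfadjoint \<open>X\<close>.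
\<close>
lemma frame_op_growth:
  obtains u where "0 \<le> u" "coord_norm m ((frame_op c ^^ r) v) = coord_norm m v * u ^ r"
    "\<And>i. i \<le> r \<Longrightarrow> coord_norm m ((frame_op c ^^ i) v) \<le> coord_norm m v * u ^ i"
proof -
  let ?e = "\<lambda>i. coord_norm m ((frame_op c ^^ i) v)"
  have convex: "(?e (Suc i))\<^sup>2 \<le> ?e i * ?e (Suc (Suc i))" for i
    using abs_coord_inner_frame_op_pow_le[where v = v and i = i and c = c and l = "Suc (Suc i)"] unfolding coord_norm_frame_op_pow_sq
    by (simp add: mult_2)
  show ?thesis
    using log_convex_geometric_bound[of ?e r, OF coord_norm_nonneg convex] that by auto
qed

text \<open>
  In terms of the spectral measure of \<open>v\<close>, this is Hoelder's inequality between the moments of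
  order \<open>0\<close>, \<open>i\<close> and \<open>2r\<close>. Splitting \<open>i\<close> into two almost equal halves of size at most \<open>r\<close> reduces
  it to the growth of norms.
\<close>
lemma frame_op_moments:
  obtains u where "0 \<le> u" "coord_inner m v ((frame_op c ^^ (2 * r)) v) = (coord_norm m v)\<^sup>2 * u ^ (2 * r)"
    "\<And>i. i \<le> 2 * r \<Longrightarrow> \<bar>coord_inner m v ((frame_op c ^^ i) v)\<bar> \<le> (coord_norm m v)\<^sup>2 * u ^ i"
proof -
  let ?e = "\<lambda>i. coord_norm m ((frame_op c ^^ i) v)"
  obtain u where u: "0 \<le> u" "?e r = coord_norm m v * u ^ r" "\<And>i. i \<le> r \<Longrightarrow> ?e i \<le> coord_norm m v * u ^ i"
    using frame_op_growth[where v = v and c = c and r = r] by blast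
  show ?thesis
  proof (rule that)
    show "0 \<le> u" by (fact u)
    show "coord_inner m v ((frame_op c ^^ (2 * r)) v) = (coord_norm m v)\<^sup>2 * u ^ (2 * r)"
      using u(2) coord_norm_frame_op_pow_sq[where v = v and c = c and i = r]
      by (simp add: power_mult_distrib mult.commute flip: power_mult)
    fix i assume "i \<le> 2 * r"
    define f where "f = i div 2"
    define g where "g = i - f"
    have fg: "i = f + g" "f \<le> r" "g \<le> r" using \<open>i \<le> 2 * r\<close> by (auto simp: f_def g_def)
    have "\<bar>coord_inner m v ((frame_op c ^^ i) v)\<bar> \<le> ?e f * ?e g" unfolding fg(1) by (rule abs_coord_inner_frame_op_pow_le)
    also have "\<dots> \<le> (coord_norm m v * u ^ f) * (coord_norm m v * u ^ g)"
      using u fg by (intro mult_mono) auto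
    finally show "\<bar>coord_inner m v ((frame_op c ^^ i) v)\<bar> \<le> (coord_norm m v)\<^sup>2 * u ^ i"
      by (simp add: fg(1) power_add power2_eq_square mult_ac)
  qed
qed

lemma frame_op_upd:
  assumes "j \<in> J" and c': "c' = c(j := c j + d)"
  shows "frame_op c' u = (\<lambda>a. frame_op c u a + (d * coord_inner m (x j) u) * x j a)"
proof
  fix a
  show "frame_op c' u a = frame_op c u a + (d * coord_inner m (x j) u) * x j a"
    unfolding frame_op_def
    by (subst (1 2) sum.remove[OF finite_J assms(1)]) (simp add: c' algebra_simps)
qed

text \<open>
  The telescoping identity \<open>W\<^sup>N - Y\<^sup>N = \<Sum>\<^bsub>i < N\<^esub> W\<^sup>i (W - Y) Y\<^bsup>N-1-i\<^esup>\<close>, where changing one weight makes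
  \<open>W - Y\<close> a multiple of \<open>x\<^sub>j \<otimes> x\<^sub>j\<close> and so splits each term into a product of two scalars.
\<close>
lemma frame_op_pow_diff:
  assumes "j \<in> J" and c': "c' = c(j := c j + d)"
  shows "coord_inner m w ((frame_op c' ^^ N) u) - coord_inner m w ((frame_op c ^^ N) u)
    = d * (\<Sum>i<N. coord_inner m w ((frame_op c' ^^ i) (x j)) * coord_inner m (x j) ((frame_op c ^^ (N - Suc i)) u))"
proof (induction N arbitrary: u)
  case (Suc N)
  have "(frame_op c' ^^ Suc N) u = (\<lambda>a. (frame_op c' ^^ N) (frame_op c u) a
      + (d * coord_inner m (x j) u) * (frame_op c' ^^ N) (x j) a)"
    unfolding funpow_Suc_right comp_apply frame_op_upd[OF assms] frame_op_pow_add ..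
  moreover have shift: "(frame_op c ^^ (N - Suc i)) (frame_op c u) = (frame_op c ^^ (N - i)) u" if "i < N" for i
    using that by (simp flip: Suc_diff_Suc) (simp add: funpow_swap1)
  ultimately have "coord_inner m w ((frame_op c' ^^ Suc N) u) - coord_inner m w ((frame_op c ^^ Suc N) u)
     = (coord_inner m w ((frame_op c' ^^ N) (frame_op c u)) - coord_inner m w ((frame_op c ^^ N) (frame_op c u)))
       + d * (coord_inner m w ((frame_op c' ^^ N) (x j)) * coord_inner m (x j) u)"
    by (simp add: coord_inner_add_right funpow_swap1)
  also have "\<dots> = d * (\<Sum>i<Suc N. coord_inner m w ((frame_op c' ^^ i) (x j)) * coord_inner m (x j) ((frame_op c ^^ (Suc N - Suc i)) u))"
    unfolding Suc.IH by (simp add: distrib_left shift)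
  finally show ?case .
qed simp

text \<open>
  A trace version of the mean value inequality \<open>w\<^bsup>2r+1\<^esup> - y\<^bsup>2r+1\<^esup> \<le> (2r + 1) (w - y) (w\<^bsup>2r\<^esup> + y\<^bsup>2r\<^esup>) / 2\<close>.
  Although \<open>W\<close> and \<open>Y\<close> need not commute, the moments that appear in the telescoping sum are
  dominated by powers of two numbers, for which the mixed terms can be compared.
\<close>
lemma frame_op_pow_diff_le:
  assumes "j \<in> J" and c': "c' = c(j := c j + d)" and "0 \<le> d"
  shows "coord_inner m (x j) ((frame_op c' ^^ Suc (2 * r)) (x j)) - coord_inner m (x j) ((frame_op c ^^ Suc (2 * r)) (x j))
    \<le> d * (coord_norm m (x j))\<^sup>2 * (real (Suc (2 * r)) / 2)
      * (coord_inner m (x j) ((frame_op c' ^^ (2 * r)) (x j)) + coord_inner m (x j) ((frame_op c ^^ (2 * r)) (x j)))"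
proof -
  let ?v = "x j" and ?h = "(coord_norm m (x j))\<^sup>2"
  obtain u where u: "0 \<le> u" "coord_inner m ?v ((frame_op c' ^^ (2 * r)) ?v) = ?h * u ^ (2 * r)"
    "\<And>i. i \<le> 2 * r \<Longrightarrow> \<bar>coord_inner m ?v ((frame_op c' ^^ i) ?v)\<bar> \<le> ?h * u ^ i"
    using frame_op_moments[where v = ?v and c = c' and r = r] by blast
  obtain w where w: "0 \<le> w" "coord_inner m ?v ((frame_op c ^^ (2 * r)) ?v) = ?h * w ^ (2 * r)"
    "\<And>i. i \<le> 2 * r \<Longrightarrow> \<bar>coord_inner m ?v ((frame_op c ^^ i) ?v)\<bar> \<le> ?h * w ^ i"
    using frame_op_moments[where v = ?v and c = c and r = r] by blast
  have "(\<Sum>i<Suc (2 * r). coord_inner m ?v ((frame_op c' ^^ i) ?v) * coord_inner m ?v ((frame_op c ^^ (Suc (2 * r) - Suc i)) ?v))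
      \<le> (\<Sum>i<Suc (2 * r). (?h * u ^ i) * (?h * w ^ (2 * r - i)))"
  proof (rule sum_mono)
    fix i assume "i \<in> {..<Suc (2 * r)}"
    then have "\<bar>coord_inner m ?v ((frame_op c' ^^ i) ?v)\<bar> * \<bar>coord_inner m ?v ((frame_op c ^^ (2 * r - i)) ?v)\<bar>
        \<le> (?h * u ^ i) * (?h * w ^ (2 * r - i))"
      using u w by (intro mult_mono) auto
    then show "coord_inner m ?v ((frame_op c' ^^ i) ?v) * coord_inner m ?v ((frame_op c ^^ (Suc (2 * r) - Suc i)) ?v)
        \<le> (?h * u ^ i) * (?h * w ^ (2 * r - i))"
      by (metis abs_le_D1 abs_mult diff_Suc_Suc)
  qed
  also have "\<dots> = ?h * ?h * (\<Sum>i<Suc (2 * r). u ^ i * w ^ (2 * r - i))"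
    unfolding sum_distrib_left by (intro sum.cong) (auto simp: mult_ac)
  also have "\<dots> \<le> ?h * ?h * (real (Suc (2 * r)) / 2 * (u ^ (2 * r) + w ^ (2 * r)))"
    using sum_mixed_powers_le[OF u(1) w(1), of "2 * r"] by (intro mult_left_mono) (auto simp: field_simps)
  finally have "d * (\<Sum>i<Suc (2 * r). coord_inner m ?v ((frame_op c' ^^ i) ?v) * coord_inner m ?v ((frame_op c ^^ (Suc (2 * r) - Suc i)) ?v))
     \<le> d * (?h * ?h * (real (Suc (2 * r)) / 2 * (u ^ (2 * r) + w ^ (2 * r))))"
    by (intro mult_left_mono assms(3))
  then show ?thesis
    unfolding frame_op_pow_diff[OF assms(1,2)] u(2) w(2)
    by (simp only: algebra_simps)
qed

text \<open>
  One factor of \<open>tr X\<^bsup>i+1\<^esup> = tr (X X\<^sup>i)\<close> is expanded. This exhibits the weights linearly, which is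
  what makes averaging over a single coin possible.
\<close>
lemma trace_pow_Suc: "trace_pow c (Suc i) = (\<Sum>j\<in>J. c j * coord_inner m (x j) ((frame_op c ^^ i) (x j)))"
proof -
  have "trace_pow c (Suc i) = (\<Sum>j\<in>J. coord_inner m (frame_op c (x j)) ((frame_op c ^^ i) (x j)))"
    by (simp add: trace_pow_def frame_op_selfadjoint)
  also have "\<dots> = (\<Sum>j\<in>J. \<Sum>l\<in>J. c l * (coord_inner m (x l) (x j) * coord_inner m (x l) ((frame_op c ^^ i) (x j))))"
    by (subst coord_inner_commute) (simp add: coord_inner_frame_op mult_ac)
  also have "\<dots> = (\<Sum>j\<in>J. \<Sum>l\<in>J. c l * (coord_inner m (x j) (x l) * coord_inner m (x j) ((frame_op c ^^ i) (x l))))"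
    by (intro sum.cong refl arg_cong2[where f = "(*)"] coord_inner_commute frame_op_pow_swap)
  also have "\<dots> = (\<Sum>l\<in>J. \<Sum>j\<in>J. c l * (coord_inner m (x j) (x l) * coord_inner m (x j) ((frame_op c ^^ i) (x l))))"
    by (rule sum.swap)
  also have "\<dots> = (\<Sum>l\<in>J. c l * coord_inner m (x l) ((frame_op c ^^ i) (x l)))"
    by (simp add: parseval flip: sum_distrib_left)
  finally show ?thesis .
qed

lemma trace_pow_even: "trace_pow c (2 * r) = (\<Sum>j\<in>J. (coord_norm m ((frame_op c ^^ r) (x j)))\<^sup>2)"
  by (simp add: trace_pow_def coord_norm_frame_op_pow_sq)

text \<open>
  The trace version of \<open>\<lambda>\<^bsup>2r+1\<^esup> \<le> (\<lambda>\<^bsup>2r+2\<^esup> + \<lambda>\<^bsup>2r\<^esup>) / 2\<close>.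
\<close>
lemma trace_pow_odd_le: "trace_pow c (Suc (2 * r)) \<le> (trace_pow c (2 * Suc r) + trace_pow c (2 * r)) / 2"
proof -
  have "coord_inner m (x j) ((frame_op c ^^ Suc (2 * r)) (x j))
      \<le> ((coord_norm m ((frame_op c ^^ Suc r) (x j)))\<^sup>2 + (coord_norm m ((frame_op c ^^ r) (x j)))\<^sup>2) / 2" for j
  proof -
    have "coord_inner m (x j) ((frame_op c ^^ Suc (2 * r)) (x j))
        \<le> coord_norm m ((frame_op c ^^ Suc r) (x j)) * coord_norm m ((frame_op c ^^ r) (x j))"
      using abs_coord_inner_le[of m "(frame_op c ^^ Suc r) (x j)" "(frame_op c ^^ r) (x j)"]
      unfolding coord_inner_frame_op_pow by (simp add: mult_2)
    then show ?thesis
      using sum_squares_bound[of "coord_norm m ((frame_op c ^^ Suc r) (x j))" "coord_norm m ((frame_op c ^^ r) (x j))"]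
      by simp
  qed
  then have "trace_pow c (Suc (2 * r)) \<le> (\<Sum>j\<in>J. ((coord_norm m ((frame_op c ^^ Suc r) (x j)))\<^sup>2 + (coord_norm m ((frame_op c ^^ r) (x j)))\<^sup>2) / 2)"
    unfolding trace_pow_def by (intro sum_mono)
  then show ?thesis
    unfolding trace_pow_even by (simp add: sum.distrib flip: sum_divide_distrib)
qed

text \<open>
  The operator norm of \<open>X\<^sup>r\<close> is at most its Hilbert-Schmidt norm.
\<close>
lemma coord_norm_pow_le_trace: "(coord_norm m ((frame_op c ^^ r) v))\<^sup>2 \<le> trace_pow c (2 * r) * (coord_norm m v)\<^sup>2"
proof -
  let ?w = "(frame_op c ^^ r) v"
  have "(coord_norm m ?w)\<^sup>2 = coord_inner m v ((frame_op c ^^ r) ?w)"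
    by (simp add: coord_norm_sq coord_inner_frame_op_pow funpow_add)
  also have "\<dots> = (\<Sum>j\<in>J. coord_inner m (x j) v * coord_inner m ((frame_op c ^^ r) (x j)) ?w)"
    by (simp only: frame_op_pow_selfadjoint parseval)
  also have "\<dots> \<le> (\<Sum>j\<in>J. \<bar>coord_inner m (x j) v\<bar> * \<bar>coord_norm m ((frame_op c ^^ r) (x j)) * coord_norm m ?w\<bar>)"
    by (rule sum_mono, rule order_trans[OF abs_ge_self])
      (auto simp: abs_mult intro!: mult_left_mono abs_coord_inner_le)
  also have "\<dots> \<le> L2_set (\<lambda>j. coord_inner m (x j) v) J * L2_set (\<lambda>j. coord_norm m ((frame_op c ^^ r) (x j)) * coord_norm m ?w) J"
    by (rule L2_set_mult_ineq)
  also have "L2_set (\<lambda>j. coord_inner m (x j) v) J = coord_norm m v"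
    unfolding L2_set_def power2_eq_square parseval by (simp flip: coord_norm_sq)
  also have "L2_set (\<lambda>j. coord_norm m ((frame_op c ^^ r) (x j)) * coord_norm m ?w) J = sqrt (trace_pow c (2 * r)) * coord_norm m ?w"
    by (simp add: L2_set_def power_mult_distrib trace_pow_even real_sqrt_mult flip: sum_distrib_right)
  finally have le: "coord_norm m ?w * coord_norm m ?w \<le> (sqrt (trace_pow c (2 * r)) * coord_norm m v) * coord_norm m ?w"
    by (simp add: power2_eq_square mult_ac)
  have tr: "0 \<le> trace_pow c (2 * r)" by (simp add: trace_pow_even sum_nonneg)
  have "coord_norm m ?w \<le> sqrt (trace_pow c (2 * r)) * coord_norm m v"
  proof (cases "coord_norm m ?w = 0")
    case False
    then have "0 < coord_norm m ?w" using coord_norm_nonneg[of m ?w] by linarith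
    then show ?thesis using le by simp
  qed (simp add: tr)
  then have "(coord_norm m ?w)\<^sup>2 \<le> (sqrt (trace_pow c (2 * r)) * coord_norm m v)\<^sup>2"
    by (intro power_mono) auto
  then show ?thesis using tr by (simp add: power_mult_distrib)
qed

text \<open>
  The bound \<open>|X\<^sup>r v| \<le> s\<^sup>r |v|\<close> passes to \<open>X\<close> itself because \<open>|X v| / |v|\<close> is at most the geometric
  mean growth rate over \<open>r\<close> steps.
\<close>
lemma coord_norm_frame_op_le:
  assumes "trace_pow c (2 * r) \<le> s ^ (2 * r)" "0 \<le> s" "1 \<le> r"
  shows "coord_norm m (frame_op c v) \<le> s * coord_norm m v"
proof (cases "coord_norm m v = 0")
  case True
  have "(coord_norm m (frame_op c v))\<^sup>2 \<le> 0"
    using coord_norm_pow_le_trace[where c = c and r = 1 and v = v] True by simp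
  then show ?thesis using True by simp
next
  case False
  then have v: "0 < coord_norm m v" using coord_norm_nonneg[of m v] by linarith
  obtain u where u: "0 \<le> u" "coord_norm m ((frame_op c ^^ r) v) = coord_norm m v * u ^ r"
     "\<And>i. i \<le> r \<Longrightarrow> coord_norm m ((frame_op c ^^ i) v) \<le> coord_norm m v * u ^ i"
    using frame_op_growth[where v = v and c = c and r = r] by blast
  have "(coord_norm m v * u ^ r)\<^sup>2 \<le> s ^ (2 * r) * (coord_norm m v)\<^sup>2"
    using coord_norm_pow_le_trace[where c = c and r = r and v = v] assms(1) unfolding u(2)
    by (meson mult_right_mono order_trans zero_le_power2)
  then have "u ^ (2 * r) \<le> s ^ (2 * r)"
    using v by (simp add: power_mult_distrib power_mult[symmetric] mult.commute)
  then have "u \<le> s"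
    using assms(2,3) u(1) by (simp add: power_mono_iff)
  then have "coord_norm m v * u ^ 1 \<le> s * coord_norm m v"
    by (simp add: mult.commute mult_right_mono)
  then show ?thesis
    using u(3)[OF assms(3)] by simp
qed

end

section \<open>Moments of the random operator\<close>

lemma finite_set_Pi_bernoulli: "finite J \<Longrightarrow> finite (set_pmf (Pi_pmf J False (\<lambda>_. bernoulli_pmf p)))"
  by (simp add: set_Pi_pmf finite_PiE_dflt)

text \<open>
  Conditioning on all coins except the \<open>j\<close>-th.
\<close>
lemma expectation_resample_coin:
  fixes F :: "('i \<Rightarrow> bool) \<Rightarrow> real"
  assumes "finite J" "j \<in> J" "0 \<le> p" "p \<le> 1"
  defines "P \<equiv> \<lambda>A. Pi_pmf A False (\<lambda>_. bernoulli_pmf p)"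
  shows "measure_pmf.expectation (P J) F
    = p * measure_pmf.expectation (P (J - {j})) (\<lambda>b. F (b(j := True)))
      + (1 - p) * measure_pmf.expectation (P (J - {j})) (\<lambda>b. F (b(j := False)))"
proof -
  have J: "J = insert j (J - {j})" using assms(2) by auto
  have "P J = bernoulli_pmf p \<bind> (\<lambda>y. map_pmf (\<lambda>b. b(j := y)) (P (J - {j})))"
    unfolding P_def by (subst J, subst Pi_pmf_insert') (use assms(1) in \<open>auto simp: map_pmf_def\<close>)
  then have "measure_pmf.expectation (P J) F
      = (\<Sum>y\<in>UNIV. pmf (bernoulli_pmf p) y *\<^sub>R measure_pmf.expectation (map_pmf (\<lambda>b. b(j := y)) (P (J - {j}))) F)"
    using assms(1) by (subst pmf_expectation_bind[symmetric, where p = "bernoulli_pmf p"])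
      (auto simp: P_def finite_set_Pi_bernoulli)
  then show ?thesis
    using assms(3,4) by (simp add: UNIV_bool)
qed

locale equal_norm_parseval_frame = parseval_frame +
  fixes p h :: real
  assumes norm_sq: "\<And>j. j \<in> J \<Longrightarrow> (coord_norm m (x j))\<^sup>2 = h"
    and p: "0 < p" "p \<le> 1"
begin

text \<open>
  The weights have mean zero under coins of bias \<open>p\<close>, and with them \<open>frame_op (weight b)\<close> is the
  deviation of \<open>(1 / p) \<Sum>\<^sub>j b\<^sub>j x\<^sub>j \<otimes> x\<^sub>j\<close> from the identity.
\<close>
definition weight :: "('i \<Rightarrow> bool) \<Rightarrow> 'i \<Rightarrow> real" where
  "weight b j = of_bool (b j) / p - 1"

abbreviation coins :: "'i set \<Rightarrow> ('i \<Rightarrow> bool) pmf" where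
  "coins A \<equiv> Pi_pmf A False (\<lambda>_. bernoulli_pmf p)"

definition moment :: "nat \<Rightarrow> real" where
  "moment i = measure_pmf.expectation (coins J) (\<lambda>b. trace_pow (weight b) i)"

lemma integrable_coins [simp]: "A \<subseteq> J \<Longrightarrow> integrable (measure_pmf (coins A)) (F :: _ \<Rightarrow> real)"
  by (intro integrable_measure_pmf_finite finite_set_Pi_bernoulli finite_subset[OF _ finite_J])

text \<open>
  The exact average over the \<open>j\<close>-th coin on the left is \<open>1 - p\<close> times the difference between the
  two outcomes. After the difference has been bounded, both outcomes carry the factor \<open>1 - p\<close>. The
  weight \<open>b\<^sub>j / p + 1\<close> on the right averages to the factors \<open>1 + p\<close> and \<open>1 - p\<close>, which are at least as
  large. This weight is chosen because the sum over \<open>j\<close> then gives traces of powers again.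
\<close>
lemma expectation_weighted_le:
  assumes j: "j \<in> J"
  defines "G \<equiv> \<lambda>i b. coord_inner m (x j) ((frame_op (weight b) ^^ i) (x j))"
  shows "measure_pmf.expectation (coins J) (\<lambda>b. weight b j * G (Suc (2 * r)) b)
    \<le> real (Suc (2 * r)) / 2 * (h / p) * measure_pmf.expectation (coins J) (\<lambda>b. (weight b j + 2) * G (2 * r) b)"
proof -
  let ?E = "measure_pmf.expectation (coins (J - {j}))"
  define K where "K = real (Suc (2 * r)) / 2 * (h / p)"
  have resample: "measure_pmf.expectation (coins J) F
      = p * ?E (\<lambda>b. F (b(j := True))) + (1 - p) * ?E (\<lambda>b. F (b(j := False)))" for F :: "_ \<Rightarrow> real"
    using expectation_resample_coin[OF finite_J j, of p F] p by simp
  have G_nonneg: "0 \<le> G (2 * r) b" for b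
    unfolding G_def coord_norm_frame_op_pow_sq[symmetric] by simp
  have h: "0 \<le> h" using norm_sq[OF j] by auto
  have step: "G (Suc (2 * r)) (b(j := True)) - G (Suc (2 * r)) (b(j := False))
      \<le> K * (G (2 * r) (b(j := True)) + G (2 * r) (b(j := False)))" for b
  proof -
    have "weight (b(j := True)) = (weight (b(j := False)))(j := weight (b(j := False)) j + 1 / p)"
      by (auto simp: weight_def)
    from frame_op_pow_diff_le[OF j this, of r] show ?thesis
      using p by (simp add: G_def K_def norm_sq[OF j] mult_ac)
  qed
  have "measure_pmf.expectation (coins J) (\<lambda>b. weight b j * G (Suc (2 * r)) b)
      = (1 - p) * ?E (\<lambda>b. G (Suc (2 * r)) (b(j := True)) - G (Suc (2 * r)) (b(j := False)))"
    unfolding resample using p by (simp add: weight_def field_simps)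
  also have "\<dots> \<le> (1 - p) * ?E (\<lambda>b. K * (G (2 * r) (b(j := True)) + G (2 * r) (b(j := False))))"
    using p step by (intro mult_left_mono integral_mono) auto
  also have "\<dots> = K * ((1 - p) * ?E (\<lambda>b. G (2 * r) (b(j := True))) + (1 - p) * ?E (\<lambda>b. G (2 * r) (b(j := False))))"
    by (simp add: distrib_left mult_ac)
  also have "\<dots> \<le> K * ((1 + p) * ?E (\<lambda>b. G (2 * r) (b(j := True))) + (1 - p) * ?E (\<lambda>b. G (2 * r) (b(j := False))))"
    using p h G_nonneg by (intro mult_left_mono add_mono mult_right_mono Bochner_Integration.integral_nonneg) (auto simp: K_def)
  also have "\<dots> = K * measure_pmf.expectation (coins J) (\<lambda>b. (weight b j + 2) * G (2 * r) b)"
    unfolding resample using p by (simp add: weight_def field_simps)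
  finally show ?thesis by (simp only: K_def)
qed

lemma moment_step:
  "moment (2 * Suc r) \<le> real (Suc (2 * r)) / 2 * (h / p) * (moment (Suc (2 * r)) + 2 * moment (2 * r))"
proof -
  let ?K = "real (Suc (2 * r)) / 2 * (h / p)"
  let ?E = "measure_pmf.expectation (coins J)"
  let ?G = "\<lambda>i j b. coord_inner m (x j) ((frame_op (weight b) ^^ i) (x j))"
  have "moment (2 * Suc r) = (\<Sum>j\<in>J. ?E (\<lambda>b. weight b j * ?G (Suc (2 * r)) j b))"
    unfolding moment_def mult_Suc_right add_2_eq_Suc trace_pow_Suc[of _ "Suc (2 * r)"] by simp
  also have "\<dots> \<le> (\<Sum>j\<in>J. ?K * ?E (\<lambda>b. (weight b j + 2) * ?G (2 * r) j b))"
    by (intro sum_mono expectation_weighted_le)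
  also have "\<dots> = ?K * (\<Sum>j\<in>J. ?E (\<lambda>b. weight b j * ?G (2 * r) j b) + 2 * ?E (?G (2 * r) j))"
    by (simp add: distrib_right sum_distrib_left)
  also have "\<dots> = ?K * (moment (Suc (2 * r)) + 2 * moment (2 * r))"
    unfolding moment_def trace_pow_Suc[of _ "2 * r"]
    by (simp add: trace_pow_def sum.distrib sum_distrib_left)
  finally show ?thesis .
qed

text \<open>
  The odd moment is replaced by even ones. The bound \<open>Q h / p \<le> 1\<close> keeps the coefficient of
  \<open>moment (2r + 2)\<close> on the right at most \<open>1 / 2\<close>, so that it can be moved to the left.
\<close>
lemma moment_growth:
  assumes "real Q * (h / p) \<le> 1" "r < Q" "0 \<le> h"
  shows "moment (2 * Suc r) \<le> (5 * (real Q * (h / p))) * moment (2 * r)"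
proof -
  define y A B where "y = real Q * (h / p)" and "A = moment (2 * Suc r)" and "B = moment (2 * r)"
  have even_nonneg: "0 \<le> moment (2 * i)" for i
    unfolding moment_def trace_pow_even by (intro Bochner_Integration.integral_nonneg sum_nonneg) auto
  then have nonneg: "0 \<le> A" "0 \<le> B" unfolding A_def B_def by blast+
  have "moment (Suc (2 * r)) \<le> measure_pmf.expectation (coins J)
      (\<lambda>b. (trace_pow (weight b) (2 * Suc r) + trace_pow (weight b) (2 * r)) / 2)"
    unfolding moment_def by (intro integral_mono trace_pow_odd_le) auto
  also have "\<dots> = (A + B) / 2"
    unfolding A_def B_def moment_def by simp
  finally have odd: "moment (Suc (2 * r)) + 2 * B \<le> (A + 5 * B) / 2" by simp
  have K: "real (Suc (2 * r)) / 2 * (h / p) \<le> y" "0 \<le> real (Suc (2 * r)) / 2 * (h / p)"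
    unfolding y_def by (rule mult_right_mono; use assms(2,3) p in simp) (use assms(3) p in simp)
  have "A \<le> real (Suc (2 * r)) / 2 * (h / p) * ((A + 5 * B) / 2)"
    using moment_step[of r, folded A_def B_def] mult_left_mono[OF odd K(2)] by (rule order_trans)
  also have "\<dots> \<le> y * ((A + 5 * B) / 2)"
    using nonneg by (intro mult_right_mono K) auto
  also have "\<dots> = y * A / 2 + 5 * (y * B) / 2"
    by (simp add: algebra_simps)
  finally have "A \<le> y * A / 2 + 5 * (y * B) / 2" .
  moreover have "y * A \<le> 1 * A"
    unfolding y_def by (intro mult_right_mono assms nonneg)
  ultimately have "A \<le> 5 * y * B" by simp
  then show ?thesis by (simp only: A_def B_def y_def)
qed

lemma trace_pow_0: "trace_pow c 0 = real (card J) * h"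
  by (simp add: trace_pow_def norm_sq flip: coord_norm_sq)

text \<open>
  Markov's inequality; the moment of order \<open>0\<close> is the dimension \<open>|J| h\<close>.
\<close>
lemma prob_trace_pow_ge:
  assumes "real Q * (h / p) \<le> 1" "0 \<le> h" "0 < s"
  shows "measure_pmf.prob (coins J) {b. s ^ (2 * Q) \<le> trace_pow (weight b) (2 * Q)}
    \<le> (5 * (real Q * (h / p)) / s\<^sup>2) ^ Q * (real (card J) * h)"
proof -
  have "measure_pmf.prob (coins J) {b. s ^ (2 * Q) \<le> trace_pow (weight b) (2 * Q)} \<le> moment (2 * Q) / s ^ (2 * Q)"
    using integral_Markov_inequality_measure[of "measure_pmf (coins J)" "\<lambda>b. trace_pow (weight b) (2 * Q)" UNIV "s ^ (2 * Q)"] assms(3)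
    by (simp add: moment_def trace_pow_even sum_nonneg)
  also have "\<dots> \<le> (5 * (real Q * (h / p))) ^ Q * moment (2 * 0) / s ^ (2 * Q)"
    using assms p by (intro divide_right_mono geometric_growth_bound[where M = "\<lambda>q. moment (2 * q)"] moment_growth) auto
  also have "moment (2 * 0) = real (card J) * h"
    by (simp add: moment_def trace_pow_0)
  finally show ?thesis
    by (simp only: power_divide power_mult times_divide_eq_left)
qed

text \<open>
  Since all \<open>|x\<^sub>j|\<^sup>2\<close> are equal, the trace of the operator determines the number of selected vectors,
  and a trace is bounded by the operator norm times the dimension.
\<close>
lemma card_selected_close:
  assumes "\<And>v. coord_norm m (frame_op (weight b) v) \<le> s * coord_norm m v" "0 < h"
  shows "\<bar>real (card {j\<in>J. b j}) / p - real (card J)\<bar> \<le> s * real (card J)"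
proof -
  have "(real (card {j\<in>J. b j}) / p - real (card J)) * h = trace_pow (weight b) 1"
  proof -
    have "(\<Sum>j\<in>J. of_bool (b j)) = real (card {j\<in>J. b j})"
      using finite_J by (simp add: Int_def)
    then show ?thesis
      unfolding One_nat_def trace_pow_Suc
      by (simp add: norm_sq weight_def sum_subtractf left_diff_distrib flip: coord_norm_sq sum_distrib_right sum_divide_distrib)
  qed
  also have "\<bar>trace_pow (weight b) 1\<bar> \<le> (\<Sum>j\<in>J. \<bar>coord_inner m (x j) (frame_op (weight b) (x j))\<bar>)"
    unfolding trace_pow_def by simp
  also have "\<dots> \<le> (\<Sum>j\<in>J. s * h)"
  proof (rule sum_mono)
    fix j assume j: "j \<in> J"
    have "\<bar>coord_inner m (x j) (frame_op (weight b) (x j))\<bar> \<le> coord_norm m (x j) * coord_norm m (frame_op (weight b) (x j))"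
      by (rule abs_coord_inner_le)
    also have "\<dots> \<le> coord_norm m (x j) * (s * coord_norm m (x j))"
      by (intro mult_left_mono assms(1)) simp
    also have "\<dots> = s * h" using norm_sq[OF j] by (simp add: power2_eq_square)
    finally show "\<bar>coord_inner m (x j) (frame_op (weight b) (x j))\<bar> \<le> s * h" .
  qed
  finally have "\<bar>real (card {j\<in>J. b j}) / p - real (card J)\<bar> * h \<le> (s * real (card J)) * h"
    using assms(2) by (simp add: abs_mult mult_ac)
  then show ?thesis using assms(2) by simp
qed

text \<open>
  With \<open>X = frame_op (weight b)\<close> and \<open>\<alpha> = |J| p / N\<close>, the operator to be bounded is
  \<open>id - \<alpha> (id + X) = (1 - \<alpha>) id - \<alpha> X\<close>. Closeness of \<open>N\<close> to \<open>|J| p\<close> gives \<open>|1 - \<alpha>| \<le> \<alpha> s\<close> and \<open>\<alpha> \<le> 4 / 3\<close>.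
\<close>
lemma coord_norm_rescaled_defect_le:
  assumes op: "\<And>v. coord_norm m (frame_op (weight b) v) \<le> s * coord_norm m v"
    and h: "0 < h" and J: "J \<noteq> {}" and s: "0 < s" "s \<le> 1 / 4"
  defines "N \<equiv> real (card {j\<in>J. b j})"
  shows "0 < N"
    "coord_norm m (\<lambda>a. v a - real (card J) / N * (\<Sum>j | j \<in> J \<and> b j. coord_inner m (x j) v * x j a)) \<le> 8 / 3 * s * coord_norm m v"
proof -
  define k where "k = real (card J)"
  have k: "0 < k" using J finite_J by (simp add: k_def card_gt_0_iff)
  have close: "\<bar>N / p - k\<bar> \<le> s * k"
    unfolding N_def k_def by (rule card_selected_close[OF op h])
  have sk: "s * k \<le> k / 4" using s k by simp
  then have Np: "3 / 4 * k \<le> N / p" "0 < N / p" using close k by linarith+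
  then show "0 < N" using p by (simp add: zero_less_divide_iff)
  define \<alpha> where "\<alpha> = k * p / N"
  have \<alpha>: "0 < \<alpha>" "\<alpha> \<le> 4 / 3"
    using Np p k \<open>0 < N\<close> by (simp_all add: \<alpha>_def field_simps)
  have "\<bar>1 - \<alpha>\<bar> = \<alpha> / k * \<bar>N / p - k\<bar>"
    using \<open>0 < N\<close> p k \<alpha> by (simp add: \<alpha>_def abs_if field_simps)
  also have "\<dots> \<le> \<alpha> / k * (s * k)"
    using \<alpha> k by (intro mult_left_mono close) auto
  finally have \<alpha>1: "\<bar>1 - \<alpha>\<bar> \<le> \<alpha> * s" using k by simp
  have expand: "frame_op (weight b) v a = (\<Sum>j | j \<in> J \<and> b j. coord_inner m (x j) v * x j a) / p - (\<Sum>j\<in>J. coord_inner m (x j) v * x j a)" for a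
  proof -
    have "(\<Sum>j | j \<in> J \<and> b j. coord_inner m (x j) v * x j a) = (\<Sum>j\<in>J. of_bool (b j) * (coord_inner m (x j) v * x j a))"
      unfolding sum.inter_filter[OF finite_J] by (intro sum.cong) auto
    then show ?thesis
      by (simp add: frame_op_def weight_def algebra_simps sum_subtractf sum_divide_distrib)
  qed
  have reproduce: "(\<Sum>j\<in>J. coord_inner m (x j) v * x j a) = v a" if "a < m" for a
  proof -
    \<comment> \<open>The frame expansion \<open>v = \<Sum>\<^sub>j \<langle>x\<^sub>j, v\<rangle> x\<^sub>j\<close> is Parseval's identity against a unit vector.\<close>
    have e: "coord_inner m u (\<lambda>c. of_bool (c = a)) = u a" for u
      using that by (simp add: coord_inner_def)
    show ?thesis using parseval[of v "\<lambda>c. of_bool (c = a)"] by (simp add: e)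
  qed
  have "(\<Sum>j | j \<in> J \<and> b j. coord_inner m (x j) v * x j a) = p * (v a + frame_op (weight b) v a)" if "a < m" for a
    using p by (simp add: expand reproduce[OF that])
  then have "coord_norm m (\<lambda>a. v a - k / N * (\<Sum>j | j \<in> J \<and> b j. coord_inner m (x j) v * x j a))
      = coord_norm m (\<lambda>a. (1 - \<alpha>) * v a + (- \<alpha>) * frame_op (weight b) v a)"
    unfolding coord_norm_def by (intro L2_set_cong) (auto simp: \<alpha>_def algebra_simps)
  also have "\<dots> \<le> \<bar>1 - \<alpha>\<bar> * coord_norm m v + \<bar>- \<alpha>\<bar> * coord_norm m (frame_op (weight b) v)"
    by (rule coord_norm_lincomb_le)
  also have "\<dots> \<le> (\<alpha> * s) * coord_norm m v + \<alpha> * (s * coord_norm m v)"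
    using \<alpha> \<alpha>1 by (intro add_mono mult_mono op) auto
  also have "\<dots> = 2 * \<alpha> * (s * coord_norm m v)" by simp
  also have "\<dots> \<le> 8 / 3 * (s * coord_norm m v)"
    using \<alpha> s by (intro mult_right_mono) auto
  finally show "coord_norm m (\<lambda>a. v a - real (card J) / N * (\<Sum>j | j \<in> J \<and> b j. coord_inner m (x j) v * x j a)) \<le> 8 / 3 * s * coord_norm m v"
    by (simp add: k_def mult_ac)
qed

end

section \<open>Operator norms of matrices\<close>

lemma index_tensor_sum:
  assumes "finite S" "\<And>j. j \<in> S \<Longrightarrow> x j \<in> carrier_vec m"
  shows "tensor_sum m x S \<in> carrier_mat m m \<and>
    (\<forall>a<m. \<forall>b<m. tensor_sum m x S $$ (a, b) = (\<Sum>j\<in>S. x j $ a * x j $ b))"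
  using assms
proof (induction S rule: finite_induct)
  case empty
  interpret abelian_group "module_mat TYPE(real) m m" by (rule abelian_group_mat)
  show ?case by (simp add: tensor_sum_def module_mat_simps)
next
  case (insert j S)
  have "tensor_sum m x (insert j S) = tensor_square (x j) + tensor_sum m x S"
    by (rule tensor_sum_insert) (use insert in auto)
  moreover have "x j \<in> carrier_vec m" using insert.prems by auto
  ultimately show ?case
    using insert by (auto simp: tensor_square_def)
qed

lemma eucl_norm_eq_coord_norm: "v \<in> carrier_vec m \<Longrightarrow> eucl_norm v = coord_norm m (vec_index v)"
  by (auto simp: eucl_norm_L2_set coord_norm_def atLeast0LessThan)

lemma scalar_prod_eq_coord_inner: "w \<in> carrier_vec m \<Longrightarrow> scalar_prod v w = coord_inner m (vec_index v) (vec_index w)"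
  by (auto simp: scalar_prod_def coord_inner_def atLeast0LessThan)

lemma op_norm_le:
  assumes "\<And>v. v \<in> carrier_vec (dim_col A) \<Longrightarrow> eucl_norm v \<le> 1 \<Longrightarrow> eucl_norm (A *\<^sub>v v) \<le> r"
  shows "op_norm A \<le> r"
proof -
  have "0\<^sub>v (dim_col A) \<in> {v \<in> carrier_vec (dim_col A). eucl_norm v \<le> 1}"
    by (simp add: eucl_norm_def)
  then show ?thesis
    unfolding op_norm_def by (intro cSUP_least) (use assms in blast)+
qed

lemma op_norm_defect_le:
  assumes "finite S" "\<And>j. j \<in> S \<Longrightarrow> x j \<in> carrier_vec m" "0 \<le> r"
    and bound: "\<And>v. coord_norm m (\<lambda>a. v a - c * (\<Sum>j\<in>S. coord_inner m (vec_index (x j)) v * x j $ a)) \<le> r * coord_norm m v"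
  shows "op_norm (1\<^sub>m m - c \<cdot>\<^sub>m tensor_sum m x S) \<le> r"
proof (rule op_norm_le)
  let ?T = "tensor_sum m x S"
  let ?A = "1\<^sub>m m - c \<cdot>\<^sub>m ?T"
  have T: "?T \<in> carrier_mat m m" "\<And>a b. a < m \<Longrightarrow> b < m \<Longrightarrow> ?T $$ (a, b) = (\<Sum>j\<in>S. x j $ a * x j $ b)"
    using index_tensor_sum[of S x m] assms(1,2) by auto
  fix v assume "v \<in> carrier_vec (dim_col ?A)" and v1: "eucl_norm v \<le> 1"
  then have v: "v \<in> carrier_vec m" using T(1) by auto
  have "(?A *\<^sub>v v) $ a = v $ a - c * (\<Sum>j\<in>S. coord_inner m (vec_index (x j)) (vec_index v) * x j $ a)" if "a < m" for a
  proof -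
    have "(?A *\<^sub>v v) $ a = (\<Sum>b<m. (of_bool (a = b) - c * (\<Sum>j\<in>S. x j $ a * x j $ b)) * v $ b)"
      using that v T by (auto simp: scalar_prod_def atLeast0LessThan of_bool_def intro!: sum.cong)
    also have "\<dots> = (\<Sum>b<m. of_bool (a = b) * v $ b) - c * (\<Sum>b<m. \<Sum>j\<in>S. x j $ a * x j $ b * v $ b)"
      by (simp add: algebra_simps sum_subtractf sum_distrib_left)
    also have "(\<Sum>b<m. of_bool (a = b) * v $ b) = v $ a"
      using that by simp
    also have "(\<Sum>b<m. \<Sum>j\<in>S. x j $ a * x j $ b * v $ b) = (\<Sum>j\<in>S. coord_inner m (vec_index (x j)) (vec_index v) * x j $ a)"
      by (subst sum.swap) (simp add: coord_inner_def sum_distrib_left sum_distrib_right mult_ac)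
    finally show ?thesis .
  qed
  moreover have Av: "?A *\<^sub>v v \<in> carrier_vec m" using T(1) by (intro carrier_vecI) simp
  ultimately have "eucl_norm (?A *\<^sub>v v)
      = coord_norm m (\<lambda>a. v $ a - c * (\<Sum>j\<in>S. coord_inner m (vec_index (x j)) (vec_index v) * x j $ a))"
    unfolding eucl_norm_eq_coord_norm[OF Av] coord_norm_def by (intro L2_set_cong) auto
  also have "\<dots> \<le> r * coord_norm m (vec_index v)" by (rule bound)
  also have "\<dots> \<le> r" using v1 assms(3) by (simp add: eucl_norm_eq_coord_norm[OF v] mult_left_le)
  finally show "eucl_norm (?A *\<^sub>v v) \<le> r" .
qed

section \<open>The tail bound\<close>

text \<open>
  The degree \<open>Q\<close> is such that the base of the power is at most \<open>1 / 3 \<le> exp (- 1)\<close>; rounding down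
  costs a factor \<open>e \<le> 6\<close>. The size of \<open>L\<close> pays for \<open>m \<le> n \<le> exp (L / 729)\<close>, and \<open>1 / 2 \<le> ln n\<close> for
  the logarithm in the final exponent: \<open>3 / 729 \<le> 1 / 240\<close>.
\<close>
lemma tail_bound_arith:
  fixes m n :: nat and t :: real
  assumes "0 < m" "1 < n" "0 < t" "t < 1"
  defines "L \<equiv> t\<^sup>2 * (real n / real m)"
  assumes large: "729 * ln (real n) < L"
  defines "Q \<equiv> nat \<lfloor>L / 240\<rfloor>"
  shows "1 \<le> Q" "real Q * (real m / real n) \<le> 1"
    "(5 * (real Q * (real m / real n)) / (t / 4)\<^sup>2) ^ Q * real m \<le> 6 * exp (- (L / (729 * ln (real n))))"
proof -
  have "ln 2 \<le> ln (real n)"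
    using assms(2) by (subst ln_le_cancel_iff) auto
  then have lnn: "1 / 2 \<le> ln (real n)"
    using ln2_ge_two_thirds by linarith
  then have L: "364 < L" using large by linarith
  have mn: "0 < real m / real n" using assms(1,2) by simp
  have t2: "t\<^sup>2 = L * (real m / real n)" using assms(1,2) by (simp add: L_def)
  have t1: "t\<^sup>2 \<le> 1" using assms(3,4) by (simp add: power_le_one)
  have Q: "real Q \<le> L / 240" "L / 240 - 1 \<le> real Q"
    using L by (simp_all add: Q_def) linarith+
  then show "1 \<le> Q" using L by linarith
  have "real Q * (real m / real n) \<le> L / 240 * (real m / real n)"
    using Q mn by (intro mult_right_mono) auto
  also have "\<dots> = t\<^sup>2 / 240" by (simp add: t2)
  finally have Qmn: "real Q * (real m / real n) \<le> t\<^sup>2 / 240" .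
  then show "real Q * (real m / real n) \<le> 1" using t1 by linarith
  have "5 * (real Q * (real m / real n)) / (t / 4)\<^sup>2 \<le> 5 * (t\<^sup>2 / 240) / (t / 4)\<^sup>2"
    using Qmn by (intro divide_right_mono mult_left_mono) auto
  also have "\<dots> = 1 / 3" using assms(3) by (simp add: power_divide)
  also have "\<dots> \<le> exp (-1)"
    using exp_le by (simp add: exp_minus field_simps)
  finally have "(5 * (real Q * (real m / real n)) / (t / 4)\<^sup>2) ^ Q \<le> exp (-1) ^ Q"
    using mn by (intro power_mono) auto
  also have "\<dots> = exp (- real Q)" by (simp flip: exp_of_nat_mult)
  finally have "(5 * (real Q * (real m / real n)) / (t / 4)\<^sup>2) ^ Q * real m \<le> exp (- real Q) * real m"
    by (rule mult_right_mono) simp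
  also have "real m \<le> exp (L / 729)"
  proof -
    have "1 < real n / real m"
    proof -
      have "t\<^sup>2 * (real n / real m) \<le> real n / real m"
        using t1 by (intro mult_left_le_one_le) auto
      then show ?thesis using L unfolding L_def by linarith
    qed
    then have "real m \<le> real n" using assms(1) by simp
    also have "\<dots> = exp (ln (real n))" using assms(2) by simp
    also have "\<dots> \<le> exp (L / 729)" using large by simp
    finally show ?thesis .
  qed
  also have "exp (- real Q) * exp (L / 729) \<le> exp (1 - L / (729 * ln (real n)))"
  proof -
    have "L / (729 * ln (real n)) \<le> L / (729 * (1 / 2))"
      using lnn L by (intro divide_left_mono mult_left_mono mult_pos_pos) auto
    also have "\<dots> = 2 / 729 * L" by simp
    finally have "L / (729 * ln (real n)) \<le> 2 / 729 * L" .
    moreover have "- real Q + L / 729 \<le> 1 - 2 / 729 * L"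
      using Q(2) L by linarith
    ultimately have "- real Q + L / 729 \<le> 1 - L / (729 * ln (real n))"
      by simp
    then show ?thesis by (simp flip: exp_add)
  qed
  also have "\<dots> = exp 1 * exp (- (L / (729 * ln (real n))))"
    by (simp flip: exp_add)
  also have "\<dots> \<le> 6 * exp (- (L / (729 * ln (real n))))"
    using exp_le by (intro mult_right_mono) auto
  finally show "(5 * (real Q * (real m / real n)) / (t / 4)\<^sup>2) ^ Q * real m \<le> 6 * exp (- (L / (729 * ln (real n))))"
    by (simp add: mult_left_mono)
qed

text \<open>
  Off the event controlled by the moment method, the operator norm of the deviation is at most
  \<open>t / 4\<close>, and renormalizing by \<open>|\<sigma>|\<close> enlarges it to at most \<open>8 / 3 \<cdot> t / 4 < t\<close>. Taking traces in
  the resolution of the identity shows that the common value of \<open>|x\<^sub>j|\<^sup>2\<close> is \<open>m / k\<close>.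
\<close>
lemma random_subset_tail:
  fixes x :: "nat \<Rightarrow> real vec"
  assumes carrier: "\<forall>j\<in>{1..k}. x j \<in> carrier_vec m"
    and norms: "\<forall>i\<in>{1..k}. \<forall>j\<in>{1..k}. eucl_norm (x i) = eucl_norm (x j)"
    and id: "1\<^sub>m m = tensor_sum m x {1..k}"
    and n: "1 < n" "n \<le> k" and m: "0 < m" and t: "0 < t" "t < 1"
    and large: "729 * ln (real n) < t\<^sup>2 * (real n / real m)"
  shows "1 - 6 * exp (- (t\<^sup>2 * (real n / real m) / (729 * ln (real n))))
    \<le> measure_pmf.prob (random_subset {1..k} (real n / real k))
            {\<sigma>. \<sigma> \<noteq> {} \<and> op_norm (1\<^sub>m m - (real k / real (card \<sigma>)) \<cdot>\<^sub>m tensor_sum m x \<sigma>) < t}"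
proof -
  let ?J = "{1..k}" and ?y = "\<lambda>j. vec_index (x j)"
  define p where "p = real n / real k"
  define h where "h = real m / real k"
  have entries: "(\<Sum>j\<in>?J. x j $ a * x j $ b) = of_bool (a = b)" if "a < m" "b < m" for a b
  proof -
    have "(\<Sum>j\<in>?J. x j $ a * x j $ b) = tensor_sum m x ?J $$ (a, b)"
      using index_tensor_sum[of ?J x m] carrier that by simp
    also have "\<dots> = of_bool (a = b)" unfolding id[symmetric] using that by simp
    finally show ?thesis .
  qed
  have norm: "(coord_norm m (?y j))\<^sup>2 = h" if j: "j \<in> ?J" for j
  proof -
    have same: "(coord_norm m (?y i))\<^sup>2 = (coord_norm m (?y j))\<^sup>2" if "i \<in> ?J" for i
      using norms carrier that j by (metis eucl_norm_eq_coord_norm)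
    have "real k * (coord_norm m (?y j))\<^sup>2 = (\<Sum>i\<in>?J. (coord_norm m (?y i))\<^sup>2)"
      by (simp add: same)
    also have "\<dots> = (\<Sum>a<m. \<Sum>i\<in>?J. x i $ a * x i $ a)"
      unfolding coord_norm_sq coord_inner_def by (rule sum.swap)
    also have "\<dots> = real m" by (simp add: entries del: One_nat_def)
    finally show ?thesis using n by (simp add: h_def field_simps)
  qed
  interpret equal_norm_parseval_frame m ?J ?y p h
    by unfold_locales (use entries norm n in \<open>auto simp: p_def\<close>)
  have h: "0 < h" and hp: "h / p = real m / real n" and kh: "real (card ?J) * h = real m"
    using m n by (auto simp: h_def p_def)
  define Q where "Q = nat \<lfloor>t\<^sup>2 * (real n / real m) / 240\<rfloor>"
  note Q = tail_bound_arith[OF m n(1) t large, folded Q_def]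
  let ?bad = "{b. (t / 4) ^ (2 * Q) \<le> trace_pow (weight b) (2 * Q)}"
  let ?good = "{\<sigma>. \<sigma> \<noteq> {} \<and> op_norm (1\<^sub>m m - (real k / real (card \<sigma>)) \<cdot>\<^sub>m tensor_sum m x \<sigma>) < t}"
  have "measure_pmf.prob (coins ?J) ?bad \<le> (5 * (real Q * (h / p)) / (t / 4)\<^sup>2) ^ Q * (real (card ?J) * h)"
    using Q(2) h t by (intro prob_trace_pow_ge) (auto simp: hp)
  also have "\<dots> \<le> 6 * exp (- (t\<^sup>2 * (real n / real m) / (729 * ln (real n))))"
    using Q(3) unfolding hp kh .
  finally have bad: "measure_pmf.prob (coins ?J) ?bad \<le> 6 * exp (- (t\<^sup>2 * (real n / real m) / (729 * ln (real n))))" .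
  have good: "{j\<in>?J. b j} \<in> ?good" if "b \<notin> ?bad" for b
  proof -
    let ?S = "{j\<in>?J. b j}"
    have op: "coord_norm m (frame_op (weight b) v) \<le> t / 4 * coord_norm m v" for v
      using that Q(1) t by (intro coord_norm_frame_op_le[where r = Q]) auto
    have J: "?J \<noteq> {}" using n by auto
    have "0 < real (card ?S)"
      using coord_norm_rescaled_defect_le(1)[OF op h J] t by simp
    then have "?S \<noteq> {}"
      by (metis card.empty less_irrefl of_nat_0)
    moreover have "op_norm (1\<^sub>m m - (real k / real (card ?S)) \<cdot>\<^sub>m tensor_sum m x ?S) \<le> 8 / 3 * (t / 4)"
    proof (rule op_norm_defect_le)
      show "coord_norm m (\<lambda>a. v a - real k / real (card ?S) * (\<Sum>j\<in>?S. coord_inner m (?y j) v * x j $ a)) \<le> 8 / 3 * (t / 4) * coord_norm m v" for v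
        using coord_norm_rescaled_defect_le(2)[OF op h J, of v] t by simp
    qed (use carrier t in auto)
    then have "op_norm (1\<^sub>m m - (real k / real (card ?S)) \<cdot>\<^sub>m tensor_sum m x ?S) < t"
      using t(1) by linarith
    ultimately show ?thesis by blast
  qed
  have "1 - measure_pmf.prob (coins ?J) ?bad = measure_pmf.prob (coins ?J) (- ?bad)"
    using measure_pmf.prob_compl[of ?bad "coins ?J"] by (simp add: Compl_eq_Diff_UNIV)
  also have "\<dots> \<le> measure_pmf.prob (coins ?J) ((\<lambda>b. {j\<in>?J. b j}) -` ?good)"
    using good by (intro measure_pmf.finite_measure_mono) auto
  also have "\<dots> = measure_pmf.prob (random_subset ?J p) ?good"
    by (simp add: random_subset_def)
  finally show ?thesis using bad by (simp add: p_def)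
qed

theorem theorem5p1:
  shows "\<exists>C::real. C > 0 \<and>
    (\<forall>(m::nat) (k::nat) (n::nat) (x :: nat \<Rightarrow> real vec).
      (\<forall>j\<in>{1..k}. x j \<in> carrier_vec m) \<longrightarrow>
      (\<forall>i\<in>{1..k}. \<forall>j\<in>{1..k}. eucl_norm (x i) = eucl_norm (x j)) \<longrightarrow>
      1\<^sub>m m = tensor_sum m x {1..k} \<longrightarrow>
      1 < n \<longrightarrow> n \<le> k \<longrightarrow>
      (\<forall>t::real. 0 < t \<longrightarrow> t < 1 \<longrightarrow>
        (let \<epsilon> = C * sqrt (ln (real n)) * sqrt (real m / real n) in
          measure_pmf.prob (random_subset {1..k} (real n / real k))
            {\<sigma>. \<sigma> \<noteq> {} \<and>
                op_norm (1\<^sub>m m - (real k / real (card \<sigma>)) \<cdot>\<^sub>m tensor_sum m x \<sigma>) < t}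
          \<ge> 1 - 6 * exp (- (t\<^sup>2 / \<epsilon>\<^sup>2)))))"
proof (intro exI[of _ 27] conjI allI impI)
  fix m k n :: nat and x :: "nat \<Rightarrow> real vec" and t :: real
  assume x: "\<forall>j\<in>{1..k}. x j \<in> carrier_vec m" "\<forall>i\<in>{1..k}. \<forall>j\<in>{1..k}. eucl_norm (x i) = eucl_norm (x j)"
    "1\<^sub>m m = tensor_sum m x {1..k}" and n: "1 < n" "n \<le> k" and t: "0 < t" "t < 1"
  define L where "L = t\<^sup>2 * (real n / real m)"
  let ?prob = "measure_pmf.prob (random_subset {1..k} (real n / real k))
            {\<sigma>. \<sigma> \<noteq> {} \<and> op_norm (1\<^sub>m m - (real k / real (card \<sigma>)) \<cdot>\<^sub>m tensor_sum m x \<sigma>) < t}"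
  have lnn: "0 < ln (real n)" using n by simp
  have eps: "t\<^sup>2 / (27 * sqrt (ln (real n)) * sqrt (real m / real n))\<^sup>2 = L / (729 * ln (real n))"
    using lnn by (simp add: L_def power_mult_distrib mult_ac)
  have "1 - 6 * exp (- (L / (729 * ln (real n)))) \<le> ?prob"
  \<comment> \<open>In the remaining case the left-hand side is negative, since \<open>6 exp (- 1) > 1\<close>. This includes
    \<open>m = 0\<close>, where \<open>L = 0\<close>.\<close>
  proof (cases "0 < m \<and> 729 * ln (real n) < L")
    case True
    then show ?thesis
      using random_subset_tail[OF x n _ t] unfolding L_def by blast
  next
    case False
    then have "L \<le> 729 * ln (real n)"
      using lnn by (cases "m = 0") (auto simp: L_def not_less)
    then have "L / (729 * ln (real n)) \<le> 1"
      using lnn by (simp add: pos_divide_le_eq)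
    then have "exp (- 1) \<le> exp (- (L / (729 * ln (real n))))" by simp
    moreover have "1 / 6 \<le> exp (- 1 :: real)"
      using exp_le by (simp add: exp_minus field_simps)
    ultimately have "1 - 6 * exp (- (L / (729 * ln (real n)))) \<le> 0" by linarith
    also have "0 \<le> ?prob" by simp
    finally show ?thesis .
  qed
  then show "let \<epsilon> = 27 * sqrt (ln (real n)) * sqrt (real m / real n) in ?prob \<ge> 1 - 6 * exp (- (t\<^sup>2 / \<epsilon>\<^sup>2))"
    by (simp only: Let_def eps)
qed simp

end
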